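(* Let $a,b,c,d$ be odd positive integers with $a^2+b^2+c^2=3d^2$, $a\le b\le c$, $\gcd(a,b,c)=1$ and $\gcd(d,c)=1$, and put $q=a^2+b^2$. For $(r,s)\in\mathbb{Z}^2$ define $$m_x=-\frac{db(3r+s)+ac(r-s)}{2q},\quad n_x=-\frac{rac+dbs}{q},\quad m_y=\frac{da(3r+s)-bc(r-s)}{2q},\quad n_y=\frac{das-bcr}{q},$$ $$m_z=\frac{r-s}{2},\quad n_z=r,\quad m_u=-\frac{rac+dbs}{q},\quad n_u=-\frac{db(s-3r)+ac(r+s)}{2q},$$ $$m_v=\frac{das-rbc}{q},\quad n_v=\frac{da(s-3r)-bc(r+s)}{2q},\quad m_w=r,\quad n_w=\frac{r+s}{2},$$ and for $m,n\in\mathbb{Z}$ let $$P_{m,n}=(m_um-n_un,\ m_vm-n_vn,\ m_wm-n_wn),\qquad Q_{m,n}=(m_xm-n_xn,\ m_ym-n_yn,\ m_zm-n_zn).$$ Then there exists a solution $(r,s)\in\mathbb{Z}^2$ of $2(a^2+b^2)=s^2+3r^2$ such that $$\mathcal{T}_{a,b,c}=\{\,\{O,P_{m,n},Q_{m,n}\} : m,n\in\mathbb{Z},\ (m,n)\neq(0,0)\,\}.$$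
   Context: $O=(0,0,0)$. $\mathcal{T}_{a,b,c}$ denotes the set of all equilateral triangles whose vertices have integer coordinates, one vertex being $O$ and the other two lying in the plane $\{(\alpha,\beta,\gamma)\in\mathbb{R}^3: a\alpha+b\beta+c\gamma=0\}$. Triangles are regarded as unordered sets of three vertices. *)

theory Defs
  imports "HOL-Analysis.Analysis"
begin

text \<open>Triangles are unordered sets of three points of \<open>\<real>\<^sup>3\<close>; the condition \<open>A \<noteq> B\<close>
  excludes the degenerate triangle consisting of a single point.\<close>

definition equilateral_triangle :: "(real^3) set \<Rightarrow> bool" where
  "equilateral_triangle T \<longleftrightarrow>
     (\<exists>A B C. T = {A, B, C} \<and> A \<noteq> B \<and> dist A B = dist B C \<and> dist B C = dist C A)"

definition integer_point :: "real^3 \<Rightarrow> bool" where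
  "integer_point X \<longleftrightarrow> (\<forall>i. X $ i \<in> \<int>)"

definition normal_plane :: "int \<Rightarrow> int \<Rightarrow> int \<Rightarrow> (real^3) set" where
  "normal_plane a b c =
     {X. real_of_int a * X $ 1 + real_of_int b * X $ 2 + real_of_int c * X $ 3 = 0}"

definition lattice_triangles :: "int \<Rightarrow> int \<Rightarrow> int \<Rightarrow> (real^3) set set" where
  "lattice_triangles a b c =
     {T. equilateral_triangle T \<and> (\<forall>X\<in>T. integer_point X) \<and>
         0 \<in> T \<and> T - {0} \<subseteq> normal_plane a b c}"

text \<open>The coefficients are a priori only rational, hence real-valued; the divisions below are
  divisions of reals, not of integers.\<close>

definition coeff_mx :: "int \<Rightarrow> int \<Rightarrow> int \<Rightarrow> int \<Rightarrow> int \<Rightarrow> int \<Rightarrow> real" where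
  "coeff_mx a b c d r s = - real_of_int (d * b * (3 * r + s) + a * c * (r - s)) / real_of_int (2 * (a\<^sup>2 + b\<^sup>2))"

definition coeff_nx :: "int \<Rightarrow> int \<Rightarrow> int \<Rightarrow> int \<Rightarrow> int \<Rightarrow> int \<Rightarrow> real" where
  "coeff_nx a b c d r s = - real_of_int (r * a * c + d * b * s) / real_of_int (a\<^sup>2 + b\<^sup>2)"

definition coeff_my :: "int \<Rightarrow> int \<Rightarrow> int \<Rightarrow> int \<Rightarrow> int \<Rightarrow> int \<Rightarrow> real" where
  "coeff_my a b c d r s = real_of_int (d * a * (3 * r + s) - b * c * (r - s)) / real_of_int (2 * (a\<^sup>2 + b\<^sup>2))"

definition coeff_ny :: "int \<Rightarrow> int \<Rightarrow> int \<Rightarrow> int \<Rightarrow> int \<Rightarrow> int \<Rightarrow> real" where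
  "coeff_ny a b c d r s = real_of_int (d * a * s - b * c * r) / real_of_int (a\<^sup>2 + b\<^sup>2)"

definition coeff_mz :: "int \<Rightarrow> int \<Rightarrow> real" where
  "coeff_mz r s = real_of_int (r - s) / 2"

definition coeff_nz :: "int \<Rightarrow> int \<Rightarrow> real" where
  "coeff_nz r s = real_of_int r"

definition coeff_mu :: "int \<Rightarrow> int \<Rightarrow> int \<Rightarrow> int \<Rightarrow> int \<Rightarrow> int \<Rightarrow> real" where
  "coeff_mu a b c d r s = - real_of_int (r * a * c + d * b * s) / real_of_int (a\<^sup>2 + b\<^sup>2)"

definition coeff_nu :: "int \<Rightarrow> int \<Rightarrow> int \<Rightarrow> int \<Rightarrow> int \<Rightarrow> int \<Rightarrow> real" where
  "coeff_nu a b c d r s = - real_of_int (d * b * (s - 3 * r) + a * c * (r + s)) / real_of_int (2 * (a\<^sup>2 + b\<^sup>2))"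

definition coeff_mv :: "int \<Rightarrow> int \<Rightarrow> int \<Rightarrow> int \<Rightarrow> int \<Rightarrow> int \<Rightarrow> real" where
  "coeff_mv a b c d r s = real_of_int (d * a * s - r * b * c) / real_of_int (a\<^sup>2 + b\<^sup>2)"

definition coeff_nv :: "int \<Rightarrow> int \<Rightarrow> int \<Rightarrow> int \<Rightarrow> int \<Rightarrow> int \<Rightarrow> real" where
  "coeff_nv a b c d r s = real_of_int (d * a * (s - 3 * r) - b * c * (r + s)) / real_of_int (2 * (a\<^sup>2 + b\<^sup>2))"

definition coeff_mw :: "int \<Rightarrow> int \<Rightarrow> real" where
  "coeff_mw r s = real_of_int r"

definition coeff_nw :: "int \<Rightarrow> int \<Rightarrow> real" where
  "coeff_nw r s = real_of_int (r + s) / 2"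

definition point_P :: "int \<Rightarrow> int \<Rightarrow> int \<Rightarrow> int \<Rightarrow> int \<Rightarrow> int \<Rightarrow> int \<Rightarrow> int \<Rightarrow> real^3" where
  "point_P a b c d r s m n =
     vector [coeff_mu a b c d r s * real_of_int m - coeff_nu a b c d r s * real_of_int n,
             coeff_mv a b c d r s * real_of_int m - coeff_nv a b c d r s * real_of_int n,
             coeff_mw r s * real_of_int m - coeff_nw r s * real_of_int n]"

definition point_Q :: "int \<Rightarrow> int \<Rightarrow> int \<Rightarrow> int \<Rightarrow> int \<Rightarrow> int \<Rightarrow> int \<Rightarrow> int \<Rightarrow> real^3" where
  "point_Q a b c d r s m n =
     vector [coeff_mx a b c d r s * real_of_int m - coeff_nx a b c d r s * real_of_int n,
             coeff_my a b c d r s * real_of_int m - coeff_ny a b c d r s * real_of_int n,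
             coeff_mz r s * real_of_int m - coeff_nz r s * real_of_int n]"

end

theory Submission
  imports Defs
begin

text \<open>An integer vector of the plane has an integral rotation by 60 degrees iff its cross product with
  the normal \<open>(a, b, c)\<close> is divisible by \<open>d\<close>. Such vectors form a module over the Eisenstein
  integers, embedded in them through the third coordinates \<open>(r, s)\<close> of the vector and of its cross
  product divided by \<open>d\<close>; by Euclidean division it is generated by one vector. All squared lengths in
  the module are multiples of \<open>2 d\<^sup>2\<close> and also of that of the generator. Since the module contains
  \<open>d (b, -a, 0)\<close>, \<open>d (c, 0, -a)\<close> and \<open>d (0, c, -b)\<close> and \<open>gcd(a, b, c) = 1\<close>, the generator has
  squared length exactly \<open>2 d\<^sup>2\<close>, which is the equation \<open>2 (a\<^sup>2 + b\<^sup>2) = s\<^sup>2 + 3 r\<^sup>2\<close>.\<close>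

section \<open>Euclidean division in the Eisenstein integers\<close>

text \<open>With \<omega> = (1 + sqrt(-3))/2, the quotient of \<open>s + r sqrt(-3)\<close> by
  \<open>s0 + r0 sqrt(-3)\<close> is rounded to \<open>m - n \<omega>\<close>. The rounding errors
  \<open>x\<close>, \<open>y\<close> are at most 1/2, so the error norm
  \<open>x^2 - x y + y^2\<close> is at most 3/4. Everything is doubled to avoid the halves in
  \<omega>.\<close>

lemma eisenstein_remainder:
  fixes r s r0 s0 :: int
  assumes "(r0, s0) \<noteq> (0, 0)"
  obtains m n :: int where
    "(2 * s - 2 * m * s0 + n * (s0 - 3 * r0))\<^sup>2 + 3 * (2 * r - 2 * m * r0 + n * (r0 + s0))\<^sup>2
      < 4 * (s0\<^sup>2 + 3 * r0\<^sup>2)"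
proof -
  define N where "N = real_of_int (s0\<^sup>2 + 3 * r0\<^sup>2)"
  have "s0\<^sup>2 + 3 * r0\<^sup>2 > 0"
    using assms by (auto simp: add_pos_nonneg add_nonneg_pos)
  then have N: "N > 0" unfolding N_def by (simp only: of_int_0_less_iff)
  \<comment> \<open>The exact quotient is \<open>\<mu> - \<nu> \<omega>\<close>: multiply by the
    conjugate of the divisor, divide by its norm \<open>N\<close>, and rewrite in the basis 1,
    \<omega>.\<close>
  define \<mu> where "\<mu> = real_of_int (s * s0 + 3 * r * r0 - (r * s0 - s * r0)) / N"
  define \<nu> where "\<nu> = real_of_int (- 2 * (r * s0 - s * r0)) / N"
  define m where "m = round \<mu>"
  define n where "n = round \<nu>"
  define x where "x = \<mu> - m"
  define y where "y = \<nu> - n"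
  have bx: "\<bar>x\<bar> \<le> 1/2" unfolding x_def m_def using of_int_round_abs_le[of \<mu>] by linarith
  have by1: "\<bar>y\<bar> \<le> 1/2" unfolding y_def n_def using of_int_round_abs_le[of \<nu>] by linarith
  have \<mu>N: "\<mu> * N = real_of_int (s * s0 + 3 * r * r0 - (r * s0 - s * r0))"
    and \<nu>N: "\<nu> * N = real_of_int (- 2 * (r * s0 - s * r0))"
    using N by (simp_all add: \<mu>_def \<nu>_def)
  have "N * (2 * real_of_int r) = N * (2 * \<mu> * r0 - \<nu> * (r0 + s0))"
  proof -
    have "N * (2 * \<mu> * r0 - \<nu> * (r0 + s0)) = 2 * (\<mu> * N) * r0 - (\<nu> * N) * (r0 + s0)"
      by (simp add: algebra_simps)
    also have "\<dots> = N * (2 * real_of_int r)"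
      unfolding \<mu>N \<nu>N unfolding N_def by (simp add: algebra_simps power2_eq_square)
    finally show ?thesis ..
  qed
  then have r: "2 * real_of_int r = 2 * \<mu> * r0 - \<nu> * (r0 + s0)" using N by simp
  have "N * (2 * real_of_int s) = N * (2 * \<mu> * s0 - \<nu> * (s0 - 3 * r0))"
  proof -
    have "N * (2 * \<mu> * s0 - \<nu> * (s0 - 3 * r0)) = 2 * (\<mu> * N) * s0 - (\<nu> * N) * (s0 - 3 * r0)"
      by (simp add: algebra_simps)
    also have "\<dots> = N * (2 * real_of_int s)"
      unfolding \<mu>N \<nu>N unfolding N_def by (simp add: algebra_simps power2_eq_square)
    finally show ?thesis ..
  qed
  then have s: "2 * real_of_int s = 2 * \<mu> * s0 - \<nu> * (s0 - 3 * r0)" using N by simp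
  have r': "real_of_int (2 * r - 2 * m * r0 + n * (r0 + s0)) = 2 * x * r0 - y * (r0 + s0)"
    using r unfolding x_def y_def by (simp add: algebra_simps)
  have s': "real_of_int (2 * s - 2 * m * s0 + n * (s0 - 3 * r0)) = 2 * x * s0 - y * (s0 - 3 * r0)"
    using s unfolding x_def y_def by (simp add: algebra_simps)
  have "x\<^sup>2 \<le> 1/4" "y\<^sup>2 \<le> 1/4"
    using power_mono[OF bx, of 2] power_mono[OF by1, of 2] by (simp_all add: power2_eq_square)
  moreover have "- (x * y) \<le> 1/4"
    using mult_mono[OF bx by1] by (simp add: abs_mult[symmetric])
  ultimately have lt: "x\<^sup>2 - x * y + y\<^sup>2 < 1" by linarith
  have "real_of_int ((2 * s - 2 * m * s0 + n * (s0 - 3 * r0))\<^sup>2 + 3 * (2 * r - 2 * m * r0 + n * (r0 + s0))\<^sup>2)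
      = (2 * x * s0 - y * (s0 - 3 * r0))\<^sup>2 + 3 * (2 * x * r0 - y * (r0 + s0))\<^sup>2"
    unfolding r'[symmetric] s'[symmetric] by simp
  also have "\<dots> = 4 * N * (x\<^sup>2 - x * y + y\<^sup>2)"
    unfolding N_def by (simp add: algebra_simps power2_eq_square)
  also have "\<dots> < 4 * N" using lt N by simp
  also have "\<dots> = real_of_int (4 * (s0\<^sup>2 + 3 * r0\<^sup>2))" by (simp add: N_def)
  finally show ?thesis using that by (simp only: of_int_less_iff)
qed

text \<open>A pair \<open>(r, s)\<close> with \<open>r \<equiv> s (mod 2)\<close> stands for the Eisenstein integer
  \<open>(s + r \<surd>-3) / 2\<close>; multiplication by the sixth root of unity \<open>(1 + \<surd>-3) / 2\<close> sends it to
  \<open>((r + s) / 2, (s - 3 r) / 2)\<close>.\<close>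

lemma eisenstein_ideal_principal:
  fixes L :: "int \<Rightarrow> int \<Rightarrow> bool"
  assumes comb: "\<And>r s r' s' m n. L r s \<Longrightarrow> L r' s' \<Longrightarrow> L (m * r + n * r') (m * s + n * s')"
    and rot: "\<And>r s. L r s \<Longrightarrow> L ((r + s) div 2) ((s - 3 * r) div 2)"
    and parity: "\<And>r s. L r s \<Longrightarrow> even (r + s)"
    and nontrivial: "L r1 s1" "(r1, s1) \<noteq> (0, 0)"
  obtains r0 s0 where "L r0 s0" "(r0, s0) \<noteq> (0, 0)"
    "\<And>r s. L r s \<Longrightarrow> \<exists>m n. 2 * r = 2 * m * r0 - n * (r0 + s0) \<and> 2 * s = 2 * m * s0 - n * (s0 - 3 * r0)"
proof -
  \<comment> \<open>The generator is a nonzero member of least norm: the remainder of any member on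
    division by it stays in \<open>L\<close> and has smaller norm, so it vanishes.\<close>
  define f where "f = (\<lambda>p :: int \<times> int. nat ((snd p)\<^sup>2 + 3 * (fst p)\<^sup>2))"
  obtain p where p: "L (fst p) (snd p) \<and> p \<noteq> (0, 0)"
    and min: "\<And>p'. L (fst p') (snd p') \<and> p' \<noteq> (0, 0) \<Longrightarrow> f p \<le> f p'"
    using ex_has_least_nat[of "\<lambda>p. L (fst p) (snd p) \<and> p \<noteq> (0, 0)" "(r1, s1)" f] nontrivial
    by (metis fst_conv snd_conv)
  obtain r0 s0 where [simp]: "p = (r0, s0)" by (cases p)
  show ?thesis
  proof (rule that)
    show L0: "L r0 s0" and nz: "(r0, s0) \<noteq> (0, 0)" using p by auto
    fix r s assume L: "L r s"
    obtain m n where lt: "(2 * s - 2 * m * s0 + n * (s0 - 3 * r0))\<^sup>2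
        + 3 * (2 * r - 2 * m * r0 + n * (r0 + s0))\<^sup>2 < 4 * (s0\<^sup>2 + 3 * r0\<^sup>2)"
      using eisenstein_remainder[OF nz] by blast
    have "even (r0 + s0)" using parity[OF L0] .
    then have dv: "2 * ((r0 + s0) div 2) = r0 + s0" "2 * ((s0 - 3 * r0) div 2) = s0 - 3 * r0"
      by (simp_all)
    define r' where "r' = r - m * r0 + n * ((r0 + s0) div 2)"
    define s' where "s' = s - m * s0 + n * ((s0 - 3 * r0) div 2)"
    have L': "L r' s'"
      using comb[OF comb[OF L L0, of 1 "- m"] rot[OF L0], of 1 n] by (simp add: r'_def s'_def)
    have r': "2 * r' = 2 * r - 2 * m * r0 + n * (r0 + s0)"
      unfolding r'_def by (subst dv(1)[symmetric]) (simp add: algebra_simps)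
    have s': "2 * s' = 2 * s - 2 * m * s0 + n * (s0 - 3 * r0)"
      unfolding s'_def by (subst dv(2)[symmetric]) (simp add: algebra_simps)
    have "s'\<^sup>2 + 3 * r'\<^sup>2 < s0\<^sup>2 + 3 * r0\<^sup>2"
      using lt unfolding r'[symmetric] s'[symmetric] by (simp add: power_mult_distrib)
    moreover have "s'\<^sup>2 + 3 * r'\<^sup>2 \<ge> 0" by simp
    ultimately have "f (r', s') < f (r0, s0)" unfolding f_def fst_conv snd_conv by linarith
    then have "(r', s') = (0, 0)" using min[of "(r', s')"] L' by fastforce
    then show "\<exists>m n. 2 * r = 2 * m * r0 - n * (r0 + s0) \<and> 2 * s = 2 * m * s0 - n * (s0 - 3 * r0)"
      using r' s' by (intro exI[of _ m] exI[of _ n]) auto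
  qed
qed

section \<open>Vectors with an integral rotation by 60 degrees\<close>

text \<open>The left side is the squared determinant of the rows \<open>(a, b, c)\<close>,
  \<open>(x, y, z)\<close>, \<open>(t, u, s)\<close>; the right side expands the determinant of
  their Gram matrix.\<close>

lemma gram_determinant:
  fixes a b c x y z t u s :: "'a :: comm_ring_1"
  shows "((b * z - c * y) * t + (c * x - a * z) * u + (a * y - b * x) * s)\<^sup>2 =
    (a\<^sup>2 + b\<^sup>2 + c\<^sup>2) * (x\<^sup>2 + y\<^sup>2 + z\<^sup>2) * (t\<^sup>2 + u\<^sup>2 + s\<^sup>2)
    + 2 * (a * x + b * y + c * z) * (x * t + y * u + z * s) * (a * t + b * u + c * s)
    - (a\<^sup>2 + b\<^sup>2 + c\<^sup>2) * (x * t + y * u + z * s)\<^sup>2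
    - (x\<^sup>2 + y\<^sup>2 + z\<^sup>2) * (a * t + b * u + c * s)\<^sup>2
    - (t\<^sup>2 + u\<^sup>2 + s\<^sup>2) * (a * x + b * y + c * z)\<^sup>2"
  by (simp add: algebra_simps power2_eq_square)

text \<open>The vector \<open>(x, y, z)\<close> lies in the plane and its cross product with the normal \<open>(a, b, c)\<close> is
  \<open>d (t, u, s)\<close>. Since \<open>|(a, b, c)| = d \<surd>3\<close>, rotating \<open>(x, y, z)\<close> in the plane by \<open>\<plusminus>60\<close> degrees
  gives \<open>((x, y, z) \<plusminus> (t, u, s)) / 2\<close>.\<close>

definition turnable :: "int \<Rightarrow> int \<Rightarrow> int \<Rightarrow> int \<Rightarrow> int \<Rightarrow> int \<Rightarrow> int \<Rightarrow> int \<Rightarrow> int \<Rightarrow> int \<Rightarrow> bool" where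
  "turnable a b c d x y z t u s \<longleftrightarrow>
     a * x + b * y + c * z = 0 \<and> b * z - c * y = d * t \<and> c * x - a * z = d * u \<and> a * y - b * x = d * s"

locale odd_normal =
  fixes a b c d :: int
  assumes odd: "odd a" "odd b" "odd c" "odd d"
    and pos: "a > 0" "d > 0"
    and norm: "a\<^sup>2 + b\<^sup>2 + c\<^sup>2 = 3 * d\<^sup>2"
    and primitive: "Gcd {a, b, c} = 1"
begin

abbreviation tn where "tn \<equiv> turnable a b c d"

lemma q_pos: "a\<^sup>2 + b\<^sup>2 > 0"
  using pos by (simp add: add_pos_nonneg)

lemma d_nonzero: "d \<noteq> 0"
  using pos by simp

lemma turnable_comb:
  assumes "tn x y z t u s" "tn x' y' z' t' u' s'"
  shows "tn (m * x + n * x') (m * y + n * y') (m * z + n * z')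
    (m * t + n * t') (m * u + n * u') (m * s + n * s')"
proof -
  have e: "a * x + b * y + c * z = 0" "b * z - c * y = d * t" "c * x - a * z = d * u" "a * y - b * x = d * s"
    "a * x' + b * y' + c * z' = 0" "b * z' - c * y' = d * t'" "c * x' - a * z' = d * u'" "a * y' - b * x' = d * s'"
    using assms by (simp_all add: turnable_def)
  show ?thesis
    unfolding turnable_def using e by (intro conjI) algebra+
qed

text \<open>Modulo 2 all of \<open>a\<close>, \<open>b\<close>, \<open>c\<close>, \<open>d\<close>
  are 1, so \<open>t\<close> is congruent to \<open>y + z\<close>, hence to \<open>x\<close> by the
  plane equation, and similarly for \<open>u\<close> and \<open>s\<close>. This makes the halves in
  the rotation integral.\<close>

lemma turnable_parity:
  assumes "tn x y z t u s"
  shows "even (x + t)" "even (y + u)" "even (z + s)"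
proof -
  have e: "even (a * x + b * y + c * z)" "even (b * z - c * y - d * t)"
    "even (c * x - a * z - d * u)" "even (a * y - b * x - d * s)"
    using assms by (simp_all add: turnable_def)
  show "even (x + t)" "even (y + u)" "even (z + s)"
    using e odd by (auto simp: even_add even_diff)
qed

text \<open>Crossing a vector of the plane twice with the normal multiplies it by minus the squared
  length \<open>3 d^2\<close> of the normal; one factor \<open>d\<close> cancels.\<close>

lemma turnable_double_cross:
  assumes "tn x y z t u s"
  shows "b * s - c * u = - 3 * d * x" "c * t - a * s = - 3 * d * y" "a * u - b * t = - 3 * d * z"
proof -
  have e: "a * x + b * y + c * z = 0" "b * z - c * y = d * t" "c * x - a * z = d * u" "a * y - b * x = d * s"
    using assms by (simp_all add: turnable_def)
  have "d * (b * s - c * u) = d * (- 3 * d * x)" using e norm by algebra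
  then show "b * s - c * u = - 3 * d * x" by (simp only: mult_cancel_left d_nonzero simp_thms)
  have "d * (c * t - a * s) = d * (- 3 * d * y)" using e norm by algebra
  then show "c * t - a * s = - 3 * d * y" by (simp only: mult_cancel_left d_nonzero simp_thms)
  have "d * (a * u - b * t) = d * (- 3 * d * z)" using e norm by algebra
  then show "a * u - b * t = - 3 * d * z" by (simp only: mult_cancel_left d_nonzero simp_thms)
qed

lemma turnable_cross_plane:
  assumes "tn x y z t u s"
  shows "a * t + b * u + c * s = 0"
proof -
  have e: "b * z - c * y = d * t" "c * x - a * z = d * u" "a * y - b * x = d * s"
    using assms by (simp_all add: turnable_def)
  have "d * (a * t + b * u + c * s) = 0" using e by algebra
  then show ?thesis using pos by simp
qed

text \<open>Crossing with the normal and dividing by \<open>d\<close> sends \<open>(x, y, z)\<close>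
  to \<open>(t, u, s)\<close> and \<open>(t, u, s)\<close> to \<open>-3 (x, y, z)\<close>; by
  linearity the half sum goes to half of \<open>(t, u, s) - 3 (x, y, z)\<close>.\<close>

lemma turnable_rotate:
  assumes "tn x y z t u s"
  shows "tn ((x + t) div 2) ((y + u) div 2) ((z + s) div 2)
    ((t - 3 * x) div 2) ((u - 3 * y) div 2) ((s - 3 * z) div 2)"
proof -
  define x' y' z' t' u' s' where
    defs: "x' = (x + t) div 2" "y' = (y + u) div 2" "z' = (z + s) div 2"
      "t' = (t - 3 * x) div 2" "u' = (u - 3 * y) div 2" "s' = (s - 3 * z) div 2"
  have h: "2 * x' = x + t" "2 * y' = y + u" "2 * z' = z + s"
    "2 * t' = t - 3 * x" "2 * u' = u - 3 * y" "2 * s' = s - 3 * z"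
    unfolding defs using turnable_parity[OF assms] by auto
  have e: "a * x + b * y + c * z = 0" "b * z - c * y = d * t" "c * x - a * z = d * u" "a * y - b * x = d * s"
    using assms by (simp_all add: turnable_def)
  note w = turnable_double_cross[OF assms] turnable_cross_plane[OF assms]
  have "2 * (a * x' + b * y' + c * z') = 0" "2 * (b * z' - c * y') = 2 * (d * t')"
    "2 * (c * x' - a * z') = 2 * (d * u')" "2 * (a * y' - b * x') = 2 * (d * s')"
    using h e w by algebra+
  then show ?thesis unfolding turnable_def defs[symmetric] by simp
qed

text \<open>The plane equation and the third cross product coordinate form a linear system for
  \<open>x\<close>, \<open>y\<close> of determinant \<open>a^2 + b^2\<close>. So \<open>z\<close>
  and \<open>s\<close> determine the vector, which is the source of the denominators in
  \<open>point_P\<close> and \<open>point_Q\<close>.\<close>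

lemma turnable_coordinates:
  assumes "tn x y z t u s"
  shows "(a\<^sup>2 + b\<^sup>2) * x = - (a * c * z) - b * d * s"
    "(a\<^sup>2 + b\<^sup>2) * y = a * d * s - b * c * z"
proof -
  have e: "a * x + b * y + c * z = 0" "a * y - b * x = d * s"
    using assms by (simp_all add: turnable_def)
  show "(a\<^sup>2 + b\<^sup>2) * x = - (a * c * z) - b * d * s"
    "(a\<^sup>2 + b\<^sup>2) * y = a * d * s - b * c * z"
    using e by algebra+
qed

text \<open>By \<open>(a x + b y)^2 + (a y - b x)^2 = (a^2 + b^2) (x^2 + y^2)\<close>, the squared
  length is the Eisenstein form in \<open>(z, s)\<close> up to a constant factor.\<close>

lemma turnable_norm:
  assumes "tn x y z t u s"
  shows "(a\<^sup>2 + b\<^sup>2) * (x\<^sup>2 + y\<^sup>2 + z\<^sup>2) = d\<^sup>2 * (s\<^sup>2 + 3 * z\<^sup>2)"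
proof -
  have e: "a * x + b * y + c * z = 0" "a * y - b * x = d * s"
    using assms by (simp_all add: turnable_def)
  show ?thesis using e norm by algebra
qed

text \<open>Bezout coefficients of \<open>(a, b, c)\<close> show that a turnable vector is congruent to a multiple
  \<open>k (a, b, c)\<close> of the normal modulo \<open>d\<close>, and the normal is isotropic modulo \<open>d\<^sup>2\<close>.\<close>

lemma turnable_norm_dvd:
  assumes "tn x y z t u s"
  shows "2 * d\<^sup>2 dvd x\<^sup>2 + y\<^sup>2 + z\<^sup>2"
proof -
  have e: "a * x + b * y + c * z = 0" "b * z - c * y = d * t" "c * x - a * z = d * u" "a * y - b * x = d * s"
    using assms by (simp_all add: turnable_def)
  have "gcd a (gcd b c) = 1" using primitive by simp
  moreover obtain i j where "i * b + j * c = gcd b c" using bezout_int by blast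
  moreover obtain k l where "k * a + l * gcd b c = gcd a (gcd b c)" using bezout_int by blast
  ultimately obtain \<alpha> \<beta> \<gamma> where bez: "\<alpha> * a + \<beta> * b + \<gamma> * c = 1"
    by (metis (no_types, opaque_lifting) add.assoc distrib_left mult.assoc)
  \<comment> \<open>Expanding the triple product of \<open>(\<alpha>, \<beta>, \<gamma>)\<close>
    with the cross product of normal and vector gives the vector as \<open>k\<close> times the
    normal plus \<open>d (X, Y, Z)\<close>, where \<open>(X, Y, Z)\<close> is the cross product of
    \<open>(t, u, s)\<close> with \<open>(\<alpha>, \<beta>, \<gamma>)\<close>.\<close>
  define k where "k = \<alpha> * x + \<beta> * y + \<gamma> * z"
  define X Y Z where "X = \<gamma> * u - \<beta> * s" "Y = \<alpha> * s - \<gamma> * t" "Z = \<beta> * t - \<alpha> * u"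
  have x: "x = k * a + d * X" and y: "y = k * b + d * Y" and z: "z = k * c + d * Z"
    using e bez unfolding k_def X_Y_Z_def by algebra+
  have "d * (a * X + b * Y + c * Z) = d * (- 3 * k * d)" using e(1) x y z norm by algebra
  then have n: "a * X + b * Y + c * Z = - 3 * k * d" by (simp only: mult_cancel_left d_nonzero simp_thms)
  have "x\<^sup>2 + y\<^sup>2 + z\<^sup>2 = d\<^sup>2 * (X\<^sup>2 + Y\<^sup>2 + Z\<^sup>2 - 3 * k\<^sup>2)" using x y z n norm by algebra
  then have "d\<^sup>2 dvd x\<^sup>2 + y\<^sup>2 + z\<^sup>2" by simp
  moreover have "even (x\<^sup>2 + y\<^sup>2 + z\<^sup>2)"
  proof -
    have "even (a * x + b * y + c * z)" using e by simp
    then show ?thesis using odd by (auto simp: even_add)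
  qed
  moreover have "coprime 2 (d\<^sup>2)" using odd by simp
  ultimately show ?thesis by (simp add: divides_mult)
qed

section \<open>The generator and its squared length\<close>

lemma lattice_generator:
  obtains r0 s0 x0 y0 t0 u0 where "tn x0 y0 r0 t0 u0 s0" "2 * (a\<^sup>2 + b\<^sup>2) = s0\<^sup>2 + 3 * r0\<^sup>2"
    "\<And>x y r t u s. tn x y r t u s \<Longrightarrow>
      \<exists>m n. 2 * r = 2 * m * r0 - n * (r0 + s0) \<and> 2 * s = 2 * m * s0 - n * (s0 - 3 * r0)"
proof -
  define L where "L = (\<lambda>r s. \<exists>x y t u. tn x y r t u s)"
  \<comment> \<open>The three members come from \<open>d (b, -a, 0)\<close>,
    \<open>d (c, 0, -a)\<close> and \<open>d (0, c, -b)\<close>, up to sign \<open>d\<close> times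
    the cross products of the normal with the unit vectors.\<close>
  have L1: "L 0 (- (a\<^sup>2 + b\<^sup>2))"
    unfolding L_def turnable_def
    by (rule exI[of _ "d * b"], rule exI[of _ "- d * a"], rule exI[of _ "c * a"], rule exI[of _ "c * b"])
      (simp add: algebra_simps power2_eq_square)
  have L2: "L (- d * a) (- b * c)"
    unfolding L_def turnable_def
    by (rule exI[of _ "d * c"], rule exI[of _ 0], rule exI[of _ "- b * a"], rule exI[of _ "c\<^sup>2 + a\<^sup>2"])
      (simp add: algebra_simps power2_eq_square)
  have L3: "L (- d * b) (a * c)"
    unfolding L_def turnable_def
    by (rule exI[of _ 0], rule exI[of _ "d * c"], rule exI[of _ "- (b\<^sup>2 + c\<^sup>2)"], rule exI[of _ "a * b"])
      (simp add: algebra_simps power2_eq_square)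
  have nz: "(0, - (a\<^sup>2 + b\<^sup>2)) \<noteq> (0, 0)" using q_pos by auto
  obtain r0 s0 where L0: "L r0 s0" "(r0, s0) \<noteq> (0, 0)"
    and gen: "\<And>r s. L r s \<Longrightarrow> \<exists>m n. 2 * r = 2 * m * r0 - n * (r0 + s0) \<and> 2 * s = 2 * m * s0 - n * (s0 - 3 * r0)"
  proof (rule eisenstein_ideal_principal[of L, OF _ _ _ L1 nz])
    show "\<And>r s r' s' m n. L r s \<Longrightarrow> L r' s' \<Longrightarrow> L (m * r + n * r') (m * s + n * s')"
      unfolding L_def by (meson turnable_comb)
    show "\<And>r s. L r s \<Longrightarrow> L ((r + s) div 2) ((s - 3 * r) div 2)"
      unfolding L_def by (meson turnable_rotate)
    show "\<And>r s. L r s \<Longrightarrow> even (r + s)"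
      unfolding L_def by (meson turnable_parity)
  qed blast
  obtain x0 y0 t0 u0 where t0: "tn x0 y0 r0 t0 u0 s0" using L0 by (auto simp: L_def)
  define q where "q = a\<^sup>2 + b\<^sup>2"
  have q: "q > 0" using q_pos by (simp add: q_def)
  define f where "f = s0\<^sup>2 + 3 * r0\<^sup>2"
  have f: "f > 0" using L0(2) by (auto simp: f_def add_pos_nonneg add_nonneg_pos)
  \<comment> \<open>The generator has squared length \<open>2 d^2 k\<close>, so its form value is
    \<open>f = 2 q k\<close>; the goal is \<open>k = 1\<close>.\<close>
  obtain k where k: "x0\<^sup>2 + y0\<^sup>2 + r0\<^sup>2 = 2 * d\<^sup>2 * k" using turnable_norm_dvd[OF t0] by (rule dvdE)
  have "d\<^sup>2 * f = d\<^sup>2 * (2 * q * k)"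
    using turnable_norm[OF t0] unfolding k q_def f_def by (simp add: algebra_simps)
  then have fk: "f = 2 * q * k" using pos by simp
  have k_pos: "k > 0" using f q unfolding fk by (simp add: zero_less_mult_iff)
  \<comment> \<open>Each member is the generator times \<open>m - n \<omega>\<close>, and the form
    is multiplicative.\<close>
  have f_dvd: "f dvd s\<^sup>2 + 3 * r\<^sup>2" if Lrs: "L r s" for r s
  proof -
    obtain m n where mn: "2 * r = 2 * m * r0 - n * (r0 + s0)" "2 * s = 2 * m * s0 - n * (s0 - 3 * r0)"
      using gen[OF Lrs] by blast
    have "4 * (s\<^sup>2 + 3 * r\<^sup>2) = (2 * s)\<^sup>2 + 3 * (2 * r)\<^sup>2" by (simp add: power_mult_distrib)
    also have "\<dots> = 4 * (f * (m\<^sup>2 - m * n + n\<^sup>2))"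
      unfolding mn f_def by (simp add: algebra_simps power2_eq_square)
    finally have "s\<^sup>2 + 3 * r\<^sup>2 = f * (m\<^sup>2 - m * n + n\<^sup>2)"
      by (metis mult_left_cancel zero_neq_numeral)
    then show ?thesis by simp
  qed
  \<comment> \<open>On the three members the form is \<open>q\<close> times
    \<open>a^2 + b^2\<close>, \<open>a^2 + c^2\<close> and \<open>b^2 + c^2\<close>. Hence
    \<open>2 k\<close> divides these pairwise sums, and \<open>k\<close> divides each of the three
    squares.\<close>
  have "(- (a\<^sup>2 + b\<^sup>2))\<^sup>2 + 3 * 0\<^sup>2 = q * (a\<^sup>2 + b\<^sup>2)"
    unfolding q_def by (simp add: power2_eq_square algebra_simps)
  then have "q * (2 * k) dvd q * (a\<^sup>2 + b\<^sup>2)"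
    using f_dvd[OF L1] by (simp only: fk) (simp only: mult_ac)
  then have k1: "2 * k dvd a\<^sup>2 + b\<^sup>2" using q by (simp only: dvd_mult_cancel_left) simp
  have "(- b * c)\<^sup>2 + 3 * (- d * a)\<^sup>2 = q * (a\<^sup>2 + c\<^sup>2)"
    using norm unfolding q_def by algebra
  then have "q * (2 * k) dvd q * (a\<^sup>2 + c\<^sup>2)"
    using f_dvd[OF L2] by (simp only: fk) (simp only: mult_ac)
  then have k2: "2 * k dvd a\<^sup>2 + c\<^sup>2" using q by (simp only: dvd_mult_cancel_left) simp
  have "(a * c)\<^sup>2 + 3 * (- d * b)\<^sup>2 = q * (b\<^sup>2 + c\<^sup>2)"
    using norm unfolding q_def by algebra
  then have "q * (2 * k) dvd q * (b\<^sup>2 + c\<^sup>2)"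
    using f_dvd[OF L3] by (simp only: fk) (simp only: mult_ac)
  then have k3: "2 * k dvd b\<^sup>2 + c\<^sup>2" using q by (simp only: dvd_mult_cancel_left) simp
  have "2 * k dvd 2 * a\<^sup>2" using dvd_diff[OF dvd_add[OF k1 k2] k3] by (simp add: algebra_simps)
  moreover have "2 * k dvd 2 * b\<^sup>2" using dvd_diff[OF dvd_add[OF k1 k3] k2] by (simp add: algebra_simps)
  moreover have "2 * k dvd 2 * c\<^sup>2" using dvd_diff[OF dvd_add[OF k2 k3] k1] by (simp add: algebra_simps)
  ultimately have kd: "k dvd a\<^sup>2" "k dvd b\<^sup>2" "k dvd c\<^sup>2" by simp_all
  have "k = 1"
  proof (rule ccontr)
    assume "k \<noteq> 1"
    then obtain p where p: "prime p" "p dvd k"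
      using prime_divisor_exists[of k] k_pos by auto
    have "p dvd a" "p dvd b" "p dvd c"
      using kd p by (meson dvd_trans prime_dvd_power)+
    then have "p dvd Gcd {a, b, c}" by (auto intro: Gcd_greatest)
    then have "p dvd 1" unfolding primitive .
    then show False using p by (auto dest: not_prime_unit)
  qed
  then have "2 * (a\<^sup>2 + b\<^sup>2) = s0\<^sup>2 + 3 * r0\<^sup>2" using fk by (simp add: f_def q_def)
  then show ?thesis
    using that[OF t0] gen unfolding L_def by blast
qed

section \<open>Equilateral triangles and turnable vectors\<close>

text \<open>The second vertex is the first one rotated by 60 degrees in one of two directions; the
  disjuncts are the two orientations, with the vertices exchanged.\<close>

lemma equilateral_turnable:
  assumes plane: "a * x + b * y + c * z = 0" "a * x' + b * y' + c * z' = 0"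
    and eq: "x'\<^sup>2 + y'\<^sup>2 + z'\<^sup>2 = x\<^sup>2 + y\<^sup>2 + z\<^sup>2"
    and ang: "2 * (x * x' + y * y' + z * z') = x\<^sup>2 + y\<^sup>2 + z\<^sup>2"
  shows "tn x y z (x - 2 * x') (y - 2 * y') (z - 2 * z') \<or> tn x' y' z' (x' - 2 * x) (y' - 2 * y) (z' - 2 * z)"
proof -
  define N where "N = x\<^sup>2 + y\<^sup>2 + z\<^sup>2"
  \<comment> \<open>\<open>(t, u, s)\<close> is twice the altitude onto the side from the origin to
    \<open>(x, y, z)\<close>. It is orthogonal to that side and to the normal, as is the cross
    product \<open>(C1, C2, C3)\<close>, which must therefore be \<open>d (t, u, s)\<close> or its
    negative.\<close>
  define t u s where V: "t = 2 * x' - x" "u = 2 * y' - y" "s = 2 * z' - z"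
  define C1 C2 C3 where C: "C1 = b * z - c * y" "C2 = c * x - a * z" "C3 = a * y - b * x"
  have Vp: "a * t + b * u + c * s = 0" using plane unfolding V by algebra
  have Vo: "x * t + y * u + z * s = 0" using ang unfolding V by algebra
  have VN: "t\<^sup>2 + u\<^sup>2 + s\<^sup>2 = 3 * N" using ang eq unfolding V N_def by algebra
  have CN: "C1\<^sup>2 + C2\<^sup>2 + C3\<^sup>2 = 3 * d\<^sup>2 * N" using plane norm unfolding C N_def by algebra
  \<comment> \<open>The squared determinant of three mutually orthogonal vectors is the product of their squared lengths.\<close>
  have "(C1 * t + C2 * u + C3 * s)\<^sup>2 = (a\<^sup>2 + b\<^sup>2 + c\<^sup>2) * N * (t\<^sup>2 + u\<^sup>2 + s\<^sup>2)"
    unfolding C N_def using gram_determinant[of b z c y t x a u s] unfolding plane(1) Vp Vo by simp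
  then have "(C1 * t + C2 * u + C3 * s)\<^sup>2 = (3 * d * N)\<^sup>2"
    unfolding VN norm by (simp add: power2_eq_square)
  then consider "C1 * t + C2 * u + C3 * s = 3 * d * N" | "C1 * t + C2 * u + C3 * s = - (3 * d * N)"
    by (auto simp: power2_eq_iff)
  then show ?thesis
  proof cases
    case 1
    \<comment> \<open>Equality case of Cauchy-Schwarz: the sum is
      \<open>3 d^2 N - 6 d^2 N + 3 d^2 N\<close>.\<close>
    have "(C1 - d * t)\<^sup>2 + (C2 - d * u)\<^sup>2 + (C3 - d * s)\<^sup>2 = 0"
      using 1 CN VN by algebra
    then have "C1 = d * t" "C2 = d * u" "C3 = d * s"
      by (simp_all add: add_nonneg_eq_0_iff)
    then have "tn x y z t u s" using plane(1) by (simp add: turnable_def C)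
    \<comment> \<open>Here rotating \<open>(x, y, z)\<close> gives \<open>(x', y', z')\<close>,
      which takes over as first vertex.\<close>
    then have "tn ((x + t) div 2) ((y + u) div 2) ((z + s) div 2)
      ((t - 3 * x) div 2) ((u - 3 * y) div 2) ((s - 3 * z) div 2)"
      by (rule turnable_rotate)
    moreover have "(x + t) div 2 = x'" "(y + u) div 2 = y'" "(z + s) div 2 = z'"
      "(t - 3 * x) div 2 = x' - 2 * x" "(u - 3 * y) div 2 = y' - 2 * y" "(s - 3 * z) div 2 = z' - 2 * z"
      unfolding V by presburger+
    ultimately show ?thesis by simp
  next
    case 2
    have "(C1 + d * t)\<^sup>2 + (C2 + d * u)\<^sup>2 + (C3 + d * s)\<^sup>2 = 0"
      using 2 CN VN by algebra
    then have "C1 + d * t = 0" "C2 + d * u = 0" "C3 + d * s = 0"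
      by (simp_all add: add_nonneg_eq_0_iff)
    then have "tn x y z (- t) (- u) (- s)" using plane(1) by (simp add: turnable_def C)
    then show ?thesis by (simp add: V)
  qed
qed

text \<open>The cross product with the normal is orthogonal to the vector and
  \<open>d sqrt(3)\<close> times as long, so \<open>(x', y', z')\<close> is the vector rotated by 60
  degrees.\<close>

lemma turnable_equilateral:
  assumes "tn x y z (x - 2 * x') (y - 2 * y') (z - 2 * z')"
  shows "a * x' + b * y' + c * z' = 0" "x'\<^sup>2 + y'\<^sup>2 + z'\<^sup>2 = x\<^sup>2 + y\<^sup>2 + z\<^sup>2"
    "2 * (x * x' + y * y' + z * z') = x\<^sup>2 + y\<^sup>2 + z\<^sup>2"
proof -
  define t u s where V: "t = x - 2 * x'" "u = y - 2 * y'" "s = z - 2 * z'"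
  have tn: "tn x y z t u s" using assms by (simp add: V)
  have e: "a * x + b * y + c * z = 0" "b * z - c * y = d * t" "c * x - a * z = d * u" "a * y - b * x = d * s"
    using tn by (simp_all add: turnable_def)
  show "a * x' + b * y' + c * z' = 0"
    using e(1) turnable_cross_plane[OF tn] unfolding V by algebra
  have "d * (x * t + y * u + z * s) = 0" using e by algebra
  then have o: "x * t + y * u + z * s = 0" using d_nonzero by simp
  have "d\<^sup>2 * (t\<^sup>2 + u\<^sup>2 + s\<^sup>2) = d\<^sup>2 * (3 * (x\<^sup>2 + y\<^sup>2 + z\<^sup>2))"
    using e norm by algebra
  then have n: "t\<^sup>2 + u\<^sup>2 + s\<^sup>2 = 3 * (x\<^sup>2 + y\<^sup>2 + z\<^sup>2)"
    by (simp only: mult_cancel_left power_eq_0_iff d_nonzero simp_thms)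
  show ang: "2 * (x * x' + y * y' + z * z') = x\<^sup>2 + y\<^sup>2 + z\<^sup>2"
    using o unfolding V by algebra
  have "4 * (x'\<^sup>2 + y'\<^sup>2 + z'\<^sup>2) = 4 * (x\<^sup>2 + y\<^sup>2 + z\<^sup>2)"
    using n ang unfolding V by algebra
  then show "x'\<^sup>2 + y'\<^sup>2 + z'\<^sup>2 = x\<^sup>2 + y\<^sup>2 + z\<^sup>2" by (metis mult_left_cancel zero_neq_numeral)
qed

text \<open>By \<open>mn\<close>, the pair of third coordinates is \<open>m - n \<omega>\<close>
  times \<open>(r, s)\<close>. Inserting this into \<open>turnable_coordinates\<close> for both
  vertices produces exactly the given coefficients.\<close>

lemma points_eq:
  assumes tn: "tn x y z (x - 2 * x') (y - 2 * y') (z - 2 * z')"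
    and mn: "2 * z = 2 * m * r - n * (r + s)" "2 * (z - 2 * z') = 2 * m * s - n * (s - 3 * r)"
  shows "point_P a b c d r s m n = vector [real_of_int x, real_of_int y, real_of_int z]"
    "point_Q a b c d r s m n = vector [real_of_int x', real_of_int y', real_of_int z']"
proof -
  define q where "q = a\<^sup>2 + b\<^sup>2"
  have q: "q > 0" using q_pos by (simp add: q_def)
  have frac: "real_of_int A / real_of_int q * real_of_int i - real_of_int B / real_of_int (2 * q) * real_of_int j = real_of_int w"
    if "2 * A * i - B * j = 2 * q * w" for A B i j w
  proof -
    have "real_of_int (2 * A * i - B * j) = real_of_int (2 * q * w)" using that by (simp only:)
    then show ?thesis using q by (simp add: field_simps)
  qed
  have frac': "real_of_int A / real_of_int (2 * q) * real_of_int i - real_of_int B / real_of_int q * real_of_int j = real_of_int w"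
    if "A * i - 2 * B * j = 2 * q * w" for A B i j w
  proof -
    have "real_of_int (A * i - 2 * B * j) = real_of_int (2 * q * w)" using that by (simp only:)
    then show ?thesis using q by (simp add: field_simps)
  qed
  note xy = turnable_coordinates[OF tn, folded q_def]
  note w = turnable_double_cross[OF tn] turnable_cross_plane[OF tn]
  have e: "a * x + b * y + c * z = 0" using tn by (simp add: turnable_def)
  \<comment> \<open>The same coordinate formulas for the second vertex, whose cross product with the
    normal is \<open>d\<close> times \<open>2 (x, y, z) - (x', y', z')\<close>.\<close>
  have xy': "2 * q * x' = - (a * c * (2 * z')) - b * d * (4 * z - 2 * z')"
    "2 * q * y' = a * d * (4 * z - 2 * z') - b * c * (2 * z')"
    using xy w e unfolding q_def by algebra+
  have P1: "2 * (- (r * a * c + d * b * s)) * m - (- (d * b * (s - 3 * r) + a * c * (r + s))) * n = 2 * q * x"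
    using xy(1) mn by algebra
  have P2: "2 * (d * a * s - r * b * c) * m - (d * a * (s - 3 * r) - b * c * (r + s)) * n = 2 * q * y"
    using xy(2) mn by algebra
  have z': "2 * z' = m * (r - s) - 2 * n * r" "4 * z - 2 * z' = m * (3 * r + s) - 2 * n * s"
    using mn by algebra+
  have Q1: "(- (d * b * (3 * r + s) + a * c * (r - s))) * m - 2 * (- (r * a * c + d * b * s)) * n = 2 * q * x'"
    using xy' z' by algebra
  have Q2: "(d * a * (3 * r + s) - b * c * (r - s)) * m - 2 * (d * a * s - b * c * r) * n = 2 * q * y'"
    using xy' z' by algebra
  have "real_of_int (2 * z) = real_of_int (2 * m * r - n * (r + s))" using mn(1) by (simp only:)
  then have P3: "real_of_int r * real_of_int m - real_of_int (r + s) / 2 * real_of_int n = real_of_int z"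
    by (simp add: field_simps)
  have "real_of_int (2 * z') = real_of_int (m * (r - s) - 2 * n * r)" using z'(1) by (simp only:)
  then have Q3: "real_of_int (r - s) / 2 * real_of_int m - real_of_int r * real_of_int n = real_of_int z'"
    by (simp add: field_simps)
  show "point_P a b c d r s m n = vector [real_of_int x, real_of_int y, real_of_int z]"
    unfolding point_P_def coeff_mu_def coeff_nu_def coeff_mv_def coeff_nv_def coeff_mw_def coeff_nw_def
      q_def[symmetric] of_int_minus[symmetric]
    by (simp only: frac[OF P1] frac[OF P2] P3)
  show "point_Q a b c d r s m n = vector [real_of_int x', real_of_int y', real_of_int z']"
    unfolding point_Q_def coeff_mx_def coeff_nx_def coeff_my_def coeff_ny_def coeff_mz_def coeff_nz_def
      q_def[symmetric] of_int_minus[symmetric]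
    by (simp only: frac'[OF Q1] frac'[OF Q2] Q3)
qed

end

section \<open>From \<open>real^3\<close> to integer coordinates\<close>

lemma norm_vector3_sq:
  "(norm (vector [x, y, z] :: real^3))\<^sup>2 = x\<^sup>2 + y\<^sup>2 + z\<^sup>2"
  by (simp add: norm_vec_def L2_set_def sum_3)

lemma equilateral_triangle_at_0:
  "equilateral_triangle T \<and> 0 \<in> T \<longleftrightarrow>
    (\<exists>A B. T = {0, A, B} \<and> A \<noteq> 0 \<and> norm B = norm A \<and> norm (A - B) = norm A)"
proof
  assume "equilateral_triangle T \<and> 0 \<in> T"
  then obtain A B C where T: "T = {A, B, C}" and ne: "A \<noteq> B" and d: "dist A B = dist B C" "dist B C = dist C A"
    and "0 \<in> {A, B, C}"
    by (auto simp: equilateral_triangle_def)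
  then consider "A = 0" | "B = 0" | "C = 0" by auto
  then show "\<exists>A B. T = {0, A, B} \<and> A \<noteq> 0 \<and> norm B = norm A \<and> norm (A - B) = norm A"
  proof cases
    case 1
    have "T = {0, B, C}" "B \<noteq> 0" "norm C = norm B" "norm (B - C) = norm B"
      using 1 T ne d by (simp_all add: dist_norm)
    then show ?thesis by blast
  next
    case 2
    have "T = {0, A, C}" using 2 T by (simp add: insert_commute)
    moreover have "A \<noteq> 0" "norm C = norm A" "norm (A - C) = norm A"
      using 2 ne d by (simp_all add: dist_norm norm_minus_commute)
    ultimately show ?thesis by blast
  next
    case 3
    have "T = {0, A, B}" using 3 T by (simp add: insert_commute)
    moreover have "A \<noteq> 0" using 3 ne d by auto
    moreover have "norm B = norm A" "norm (A - B) = norm A"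
      using 3 d by (simp_all add: dist_norm)
    ultimately show ?thesis by blast
  qed
next
  assume "\<exists>A B. T = {0, A, B} \<and> A \<noteq> 0 \<and> norm B = norm A \<and> norm (A - B) = norm A"
  then obtain A B where T: "T = {0, A, B}" and "A \<noteq> 0" "norm B = norm A" "norm (A - B) = norm A" by blast
  then have "0 \<noteq> A" "dist 0 A = dist A B" "dist A B = dist B 0" by (simp_all add: dist_norm)
  then show "equilateral_triangle T \<and> 0 \<in> T"
    unfolding equilateral_triangle_def using T by blast
qed

lemma equilateral_coordinates:
  fixes x y z x' y' z' :: int
  defines "A \<equiv> vector [real_of_int x, real_of_int y, real_of_int z] :: real^3"
    and "B \<equiv> vector [real_of_int x', real_of_int y', real_of_int z'] :: real^3"
  shows "norm B = norm A \<and> norm (A - B) = norm A \<longleftrightarrow>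
    x'\<^sup>2 + y'\<^sup>2 + z'\<^sup>2 = x\<^sup>2 + y\<^sup>2 + z\<^sup>2 \<and> 2 * (x * x' + y * y' + z * z') = x\<^sup>2 + y\<^sup>2 + z\<^sup>2"
proof -
  have AB: "A - B = vector [real_of_int (x - x'), real_of_int (y - y'), real_of_int (z - z')]"
    by (simp add: A_def B_def vec_eq_iff forall_3)
  have n: "norm v = norm w \<longleftrightarrow> (norm v)\<^sup>2 = (norm w)\<^sup>2" for v w :: "real^3"
    by simp
  have "norm B = norm A \<longleftrightarrow> real_of_int (x'\<^sup>2 + y'\<^sup>2 + z'\<^sup>2) = real_of_int (x\<^sup>2 + y\<^sup>2 + z\<^sup>2)"
    unfolding n A_def B_def norm_vector3_sq by simp
  then have 1: "norm B = norm A \<longleftrightarrow> x'\<^sup>2 + y'\<^sup>2 + z'\<^sup>2 = x\<^sup>2 + y\<^sup>2 + z\<^sup>2"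
    by (simp only: of_int_eq_iff)
  have "norm (A - B) = norm A \<longleftrightarrow>
      real_of_int ((x - x')\<^sup>2 + (y - y')\<^sup>2 + (z - z')\<^sup>2) = real_of_int (x\<^sup>2 + y\<^sup>2 + z\<^sup>2)"
    unfolding n AB unfolding A_def norm_vector3_sq by simp
  then have 2: "norm (A - B) = norm A \<longleftrightarrow> (x - x')\<^sup>2 + (y - y')\<^sup>2 + (z - z')\<^sup>2 = x\<^sup>2 + y\<^sup>2 + z\<^sup>2"
    by (simp only: of_int_eq_iff)
  show ?thesis unfolding 1 2 by (auto simp: power2_eq_square algebra_simps)
qed

lemma integer_point_iff:
  "integer_point X \<longleftrightarrow> (\<exists>x y z :: int. X = vector [real_of_int x, real_of_int y, real_of_int z])"
  by (auto simp: integer_point_def forall_3 vec_eq_iff elim!: Ints_cases)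

lemma normal_plane_iff:
  "vector [real_of_int x, real_of_int y, real_of_int z] \<in> normal_plane a b c \<longleftrightarrow> a * x + b * y + c * z = 0"
proof -
  have "vector [real_of_int x, real_of_int y, real_of_int z] \<in> normal_plane a b c \<longleftrightarrow>
      real_of_int (a * x + b * y + c * z) = real_of_int 0"
    by (simp add: normal_plane_def)
  then show ?thesis by (simp only: of_int_eq_iff)
qed

lemma lattice_triangles_iff:
  "T \<in> lattice_triangles a b c \<longleftrightarrow>
    (\<exists>x y z x' y' z' :: int.
      T = {0, vector [real_of_int x, real_of_int y, real_of_int z],
              vector [real_of_int x', real_of_int y', real_of_int z']} \<and>
      (x, y, z) \<noteq> (0, 0, 0) \<and> a * x + b * y + c * z = 0 \<and> a * x' + b * y' + c * z' = 0 \<and>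
      x'\<^sup>2 + y'\<^sup>2 + z'\<^sup>2 = x\<^sup>2 + y\<^sup>2 + z\<^sup>2 \<and> 2 * (x * x' + y * y' + z * z') = x\<^sup>2 + y\<^sup>2 + z\<^sup>2)"
  (is "?l \<longleftrightarrow> ?r")
proof
  have nz: "vector [real_of_int x, real_of_int y, real_of_int z] \<noteq> (0 :: real^3) \<longleftrightarrow> (x, y, z) \<noteq> (0, 0, 0)" for x y z
    by (auto simp: vec_eq_iff forall_3)
  {
    assume ?l
    then have "equilateral_triangle T \<and> 0 \<in> T" and int: "\<forall>X\<in>T. integer_point X"
      and plane: "T - {0} \<subseteq> normal_plane a b c"
      by (auto simp: lattice_triangles_def)
    then obtain A B where T: "T = {0, A, B}" and A: "A \<noteq> 0"
      and AB: "norm B = norm A \<and> norm (A - B) = norm A"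
      unfolding equilateral_triangle_at_0 by blast
    have B: "B \<noteq> 0" using A AB by auto
    obtain x y z where Ax: "A = vector [real_of_int x, real_of_int y, real_of_int z]"
      using int T integer_point_iff by blast
    obtain x' y' z' where Bx: "B = vector [real_of_int x', real_of_int y', real_of_int z']"
      using int T integer_point_iff by blast
    have "A \<in> normal_plane a b c" "B \<in> normal_plane a b c" using A B T plane by auto
    then have "a * x + b * y + c * z = 0" "a * x' + b * y' + c * z' = 0"
      by (simp_all only: Ax Bx normal_plane_iff)
    moreover have "(x, y, z) \<noteq> (0, 0, 0)" using A unfolding Ax nz .
    moreover note AB[unfolded Ax Bx equilateral_coordinates]
    ultimately show ?r unfolding T Ax Bx by blast
  next
    assume ?r
    then obtain x y z x' y' z' where
      T: "T = {0, vector [real_of_int x, real_of_int y, real_of_int z],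
              vector [real_of_int x', real_of_int y', real_of_int z']}"
      and n: "(x, y, z) \<noteq> (0, 0, 0)" and p: "a * x + b * y + c * z = 0" "a * x' + b * y' + c * z' = 0"
      and e: "x'\<^sup>2 + y'\<^sup>2 + z'\<^sup>2 = x\<^sup>2 + y\<^sup>2 + z\<^sup>2 \<and> 2 * (x * x' + y * y' + z * z') = x\<^sup>2 + y\<^sup>2 + z\<^sup>2"
      by blast
    have "equilateral_triangle T \<and> 0 \<in> T"
      unfolding equilateral_triangle_at_0 using T n[folded nz] e[folded equilateral_coordinates] by blast
    moreover have "\<forall>X\<in>T. integer_point X"
      unfolding T by (auto simp: integer_point_def forall_3)
    moreover have "T - {0} \<subseteq> normal_plane a b c"
      unfolding T using p[folded normal_plane_iff] by auto
    ultimately show ?l by (simp add: lattice_triangles_def)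
  }
qed

section \<open>Parametrization of all triangles by the generator\<close>

theorem theorem6p1:
  fixes a b c d :: int
  assumes "odd a" and "odd b" and "odd c" and "odd d"
    and "a > 0" and "b > 0" and "c > 0" and "d > 0"
    and "a\<^sup>2 + b\<^sup>2 + c\<^sup>2 = 3 * d\<^sup>2"
    and "a \<le> b" and "b \<le> c"
    and "Gcd {a, b, c} = 1"
    and "gcd d c = 1"
  shows "\<exists>r s :: int. 2 * (a\<^sup>2 + b\<^sup>2) = s\<^sup>2 + 3 * r\<^sup>2 \<and>
    lattice_triangles a b c =
      {{0, point_P a b c d r s m n, point_Q a b c d r s m n} | m n :: int. (m, n) \<noteq> (0, 0)}"
proof -
  interpret odd_normal a b c d
    using assms by unfold_locales
  obtain r s x0 y0 t0 u0 where gen: "tn x0 y0 r t0 u0 s" and rs: "2 * (a\<^sup>2 + b\<^sup>2) = s\<^sup>2 + 3 * r\<^sup>2"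
    and span: "\<And>x y z t u w. tn x y z t u w \<Longrightarrow>
      \<exists>m n. 2 * z = 2 * m * r - n * (r + s) \<and> 2 * w = 2 * m * s - n * (s - 3 * r)"
    by (rule lattice_generator) blast
  have pts: "\<exists>m n. (m, n) \<noteq> (0, 0) \<and>
      vector [real_of_int x, real_of_int y, real_of_int z] = point_P a b c d r s m n \<and>
      vector [real_of_int x', real_of_int y', real_of_int z'] = point_Q a b c d r s m n"
    if tn: "tn x y z (x - 2 * x') (y - 2 * y') (z - 2 * z')" and nz: "(x, y, z) \<noteq> (0, 0, 0)"
    for x y z x' y' z'
  proof -
    obtain m n where mn: "2 * z = 2 * m * r - n * (r + s)" "2 * (z - 2 * z') = 2 * m * s - n * (s - 3 * r)"
      using span[OF tn] by blast
    have "(m, n) \<noteq> (0, 0)"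
    proof
      assume "(m, n) = (0, 0)"
      then have "z = 0" "z - 2 * z' = 0" using mn by simp_all
      then have "(a\<^sup>2 + b\<^sup>2) * x = 0" "(a\<^sup>2 + b\<^sup>2) * y = 0" using turnable_coordinates[OF tn] by simp_all
      then show False using nz q_pos \<open>z = 0\<close> by auto
    qed
    then show ?thesis unfolding points_eq[OF tn mn, symmetric] by blast
  qed
  have "T \<in> lattice_triangles a b c \<longleftrightarrow>
      (\<exists>m n. T = {0, point_P a b c d r s m n, point_Q a b c d r s m n} \<and> (m, n) \<noteq> (0, 0))" for T
  proof
    assume "T \<in> lattice_triangles a b c"
    then obtain x y z x' y' z' where
      T: "T = {0, vector [real_of_int x, real_of_int y, real_of_int z],
              vector [real_of_int x', real_of_int y', real_of_int z']}"
      and n: "(x, y, z) \<noteq> (0, 0, 0)" and p: "a * x + b * y + c * z = 0" "a * x' + b * y' + c * z' = 0"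
      and e: "x'\<^sup>2 + y'\<^sup>2 + z'\<^sup>2 = x\<^sup>2 + y\<^sup>2 + z\<^sup>2" "2 * (x * x' + y * y' + z * z') = x\<^sup>2 + y\<^sup>2 + z\<^sup>2"
      unfolding lattice_triangles_iff by blast
    have n': "(x', y', z') \<noteq> (0, 0, 0)"
    proof
      assume "(x', y', z') = (0, 0, 0)"
      then have "x\<^sup>2 + y\<^sup>2 + z\<^sup>2 = 0" using e by simp
      then show False using n by (simp add: add_nonneg_eq_0_iff)
    qed
    from equilateral_turnable[OF p e]
    show "\<exists>m n. T = {0, point_P a b c d r s m n, point_Q a b c d r s m n} \<and> (m, n) \<noteq> (0, 0)"
    proof
      assume "tn x y z (x - 2 * x') (y - 2 * y') (z - 2 * z')"
      from pts[OF this n] obtain m n where mn: "(m, n) \<noteq> (0, 0)"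
        and PQ: "vector [real_of_int x, real_of_int y, real_of_int z] = point_P a b c d r s m n"
          "vector [real_of_int x', real_of_int y', real_of_int z'] = point_Q a b c d r s m n"
        by blast
      have "T = {0, point_P a b c d r s m n, point_Q a b c d r s m n}"
        unfolding T PQ by (rule refl)
      then show ?thesis using mn by blast
    next
      \<comment> \<open>In the other orientation the vertices swap roles, which leaves the unordered
        triangle unchanged.\<close>
      assume "tn x' y' z' (x' - 2 * x) (y' - 2 * y) (z' - 2 * z)"
      from pts[OF this n'] obtain m n where mn: "(m, n) \<noteq> (0, 0)"
        and PQ: "vector [real_of_int x', real_of_int y', real_of_int z'] = point_P a b c d r s m n"
          "vector [real_of_int x, real_of_int y, real_of_int z] = point_Q a b c d r s m n"
        by blast
      have "T = {0, point_P a b c d r s m n, point_Q a b c d r s m n}"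
        unfolding T PQ by (simp only: insert_commute)
      then show ?thesis using mn by blast
    qed
  next
    assume "\<exists>m n. T = {0, point_P a b c d r s m n, point_Q a b c d r s m n} \<and> (m, n) \<noteq> (0, 0)"
    then obtain m n where T: "T = {0, point_P a b c d r s m n, point_Q a b c d r s m n}"
      and mn: "(m, n) \<noteq> (0, 0)" by blast
    \<comment> \<open>These are the third coordinates of \<open>m\<close> times the generator minus
      \<open>n\<close> times its rotation, and of the associated cross product divided by
      \<open>d\<close>.\<close>
    define z w where z: "z = m * r + - n * ((r + s) div 2)" and w: "w = m * s + - n * ((s - 3 * r) div 2)"
    obtain x y t u where tn: "tn x y z t u w"
      using turnable_comb[OF gen turnable_rotate[OF gen], of m "- n"] unfolding z w by blast
    have dv: "2 * ((r + s) div 2) = r + s" "2 * ((s - 3 * r) div 2) = s - 3 * r"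
      using turnable_parity(3)[OF gen] by auto
    define x' y' z' where B: "x' = (x - t) div 2" "y' = (y - u) div 2" "z' = (z - w) div 2"
    have tuw: "t = x - 2 * x'" "u = y - 2 * y'" "w = z - 2 * z'"
      unfolding B using turnable_parity[OF tn] by auto
    have z2: "2 * z = 2 * m * r - n * (r + s)"
      unfolding z by (subst dv(1)[symmetric]) (simp add: algebra_simps)
    have w2: "2 * w = 2 * m * s - n * (s - 3 * r)"
      unfolding w by (subst dv(2)[symmetric]) (simp add: algebra_simps)
    note tn' = tn[unfolded tuw] and w' = w2[unfolded tuw]
    \<comment> \<open>Multiplicativity of the form, with \<open>(2 m - n)^2 + 3 n^2\<close> four
      times the norm of \<open>m - n \<omega>\<close>; it shows that the first vertex is not the
      origin.\<close>
    have "4 * (w\<^sup>2 + 3 * z\<^sup>2) = (s\<^sup>2 + 3 * r\<^sup>2) * ((2 * m - n)\<^sup>2 + 3 * n\<^sup>2)"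
      using z2 w2 by algebra
    moreover have "s\<^sup>2 + 3 * r\<^sup>2 > 0"
      unfolding rs[symmetric] using q_pos by (rule mult_pos_pos[OF zero_less_numeral])
    moreover have "(2 * m - n)\<^sup>2 + 3 * n\<^sup>2 > 0"
      using mn by (cases "n = 0") (auto simp: add_nonneg_pos)
    ultimately have "4 * (w\<^sup>2 + 3 * z\<^sup>2) > 0" by (simp only: mult_pos_pos)
    then have "w\<^sup>2 + 3 * z\<^sup>2 \<noteq> 0" by (simp only: zero_less_mult_iff) auto
    then have "(a\<^sup>2 + b\<^sup>2) * (x\<^sup>2 + y\<^sup>2 + z\<^sup>2) \<noteq> 0"
      unfolding turnable_norm[OF tn] using d_nonzero by (simp only: mult_eq_0_iff power_eq_0_iff) simp
    then have nz: "(x, y, z) \<noteq> (0, 0, 0)" by auto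
    have plane: "a * x + b * y + c * z = 0" using tn by (simp add: turnable_def)
    show "T \<in> lattice_triangles a b c"
      unfolding lattice_triangles_iff
      using T[unfolded points_eq[OF tn' z2 w']] nz plane turnable_equilateral[OF tn']
      by (intro exI conjI)
  qed
  then have "lattice_triangles a b c =
      {{0, point_P a b c d r s m n, point_Q a b c d r s m n} | m n. (m, n) \<noteq> (0, 0)}"
    by (intro set_eqI) (simp only: mem_Collect_eq)
  then show ?thesis using rs by (intro exI conjI)
qed

end
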